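(* Let $A$ and $B$ be unital complex Banach algebras, and let $\phi:A\to B$ be a unital continuous algebra morphism which is dense (i.e. $\phi(A)$ is dense in $B$) and spectral (i.e. $\mathrm{sp}_B(\phi(a))=\mathrm{sp}_A(a)$ for all $a\in A$). Then $\mathrm{csr}\,A=\mathrm{csr}\,B$ and $\mathrm{gsr}\,A=\mathrm{gsr}\,B$.
   Context: For a unital Banach algebra $A$ and $m\ge 1$, $\mathrm{Lg}_m(A)=\{(a_1,\dots,a_m)\in A^m : Aa_1+\dots+Aa_m=A\}$. The group $\mathrm{GL}_m(A)$ acts on $\mathrm{Lg}_m(A)$ by $\underline{a}\mapsto \alpha\cdot\underline{a}^T$ (matrix times column vector), and $\mathrm{GL}_m^0(A)$ denotes the connected component of the identity in $\mathrm{GL}_m(A)$. The connected stable rank $\mathrm{csr}\,A$ is the least $n\ge 1$ such that $\mathrm{GL}_m^0(A)$ acts transitively on $\mathrm{Lg}_m(A)$ for all $m\ge n$ (equivalently, $\mathrm{Lg}_m(A)$ is connected for all $m\ge n$). The general stable rank $\mathrm{gsr}\,A$ is the least $n\ge1$ such that $\mathrm{GL}_m(A)$ acts transitively on $\mathrm{Lg}_m(A)$ for all $m\ge n$ (equivalently, for all $m\ge n$, any right $A$-module $P$ with $P\oplus A\simeq A^m$ satisfies $P\simeq A^{m-1}$). Each rank is set to be $\infty$ if no such $n$ exists. $\mathrm{sp}_A(a)$ denotes the spectrum of $a$ in $A$. *)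

theory Defs
  imports "HOL-Analysis.Analysis" "HOL-Library.Extended_Nat"
begin

(* Unital complex Banach algebras.  Neither 0 \<noteq> 1 nor norm 1 = 1 is required, so the class is
   based on monoid_mult instead of ring_1 / real_normed_algebra_1.  The real structure inherited
   from real_normed_algebra is the restriction of the complex one. *)
class complex_unital_banach_algebra = real_normed_algebra + monoid_mult + banach +
  fixes scaleC :: "complex \<Rightarrow> 'a \<Rightarrow> 'a"  (infixr \<open>*\<^sub>C\<close> 75)
  assumes scaleC_add_right: "c *\<^sub>C (x + y) = c *\<^sub>C x + c *\<^sub>C y"
    and scaleC_add_left: "(c + d) *\<^sub>C x = c *\<^sub>C x + d *\<^sub>C x"
    and scaleC_scaleC: "c *\<^sub>C (d *\<^sub>C x) = (c * d) *\<^sub>C x"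
    and scaleC_one: "1 *\<^sub>C x = x"
    and scaleC_of_real: "complex_of_real r *\<^sub>C x = r *\<^sub>R x"
    and mult_scaleC_left: "(c *\<^sub>C x) * y = c *\<^sub>C (x * y)"
    and mult_scaleC_right: "x * (c *\<^sub>C y) = c *\<^sub>C (x * y)"
    and norm_scaleC: "norm (c *\<^sub>C x) = cmod c * norm x"

definition invertible_elem :: "'a::monoid_mult \<Rightarrow> bool" where
  "invertible_elem x \<longleftrightarrow> (\<exists>y. x * y = 1 \<and> y * x = 1)"

definition spectrum :: "'a::complex_unital_banach_algebra \<Rightarrow> complex set" where
  "spectrum a = {c. \<not> invertible_elem (a - c *\<^sub>C 1)}"

definition unital_algebra_morphism ::
  "('a::complex_unital_banach_algebra \<Rightarrow> 'b::complex_unital_banach_algebra) \<Rightarrow> bool" where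
  "unital_algebra_morphism \<phi> \<longleftrightarrow>
     (\<forall>x y. \<phi> (x + y) = \<phi> x + \<phi> y) \<and>
     (\<forall>c x. \<phi> (c *\<^sub>C x) = c *\<^sub>C \<phi> x) \<and>
     (\<forall>x y. \<phi> (x * y) = \<phi> x * \<phi> y) \<and>
     \<phi> 1 = 1"

definition dense_morphism :: "('a \<Rightarrow> 'b::topological_space) \<Rightarrow> bool" where
  "dense_morphism \<phi> \<longleftrightarrow> closure (range \<phi>) = UNIV"

definition spectral_morphism ::
  "('a::complex_unital_banach_algebra \<Rightarrow> 'b::complex_unital_banach_algebra) \<Rightarrow> bool" where
  "spectral_morphism \<phi> \<longleftrightarrow> (\<forall>a. spectrum (\<phi> a) = spectrum a)"

(* The size m ranges over nat inside the definitions of the stable ranks, so m-tuples and m x m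
   matrices are functions on nat with indices 0, ..., m - 1 that vanish at all other indices.
   The product topology that the library puts on function types restricts on these sets to the
   usual topology of A^m and of the m x m matrices over A. *)
definition tuples :: "nat \<Rightarrow> (nat \<Rightarrow> 'a::zero) set" where
  "tuples m = {a. \<forall>i. \<not> i < m \<longrightarrow> a i = 0}"

definition matrices :: "nat \<Rightarrow> (nat \<Rightarrow> nat \<Rightarrow> 'a::zero) set" where
  "matrices m = {M. \<forall>i j. \<not> (i < m \<and> j < m) \<longrightarrow> M i j = 0}"

definition one_matrix :: "nat \<Rightarrow> nat \<Rightarrow> nat \<Rightarrow> 'a::{zero, one}" where
  "one_matrix m = (\<lambda>i j. if i < m \<and> i = j then 1 else 0)"

definition matrix_times ::
  "nat \<Rightarrow> (nat \<Rightarrow> nat \<Rightarrow> 'a::semiring_0) \<Rightarrow> (nat \<Rightarrow> nat \<Rightarrow> 'a) \<Rightarrow> nat \<Rightarrow> nat \<Rightarrow> 'a" where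
  "matrix_times m M N = (\<lambda>i j. \<Sum>k<m. M i k * N k j)"

definition matrix_act ::
  "nat \<Rightarrow> (nat \<Rightarrow> nat \<Rightarrow> 'a::semiring_0) \<Rightarrow> (nat \<Rightarrow> 'a) \<Rightarrow> nat \<Rightarrow> 'a" where
  "matrix_act m M a = (\<lambda>i. \<Sum>j<m. M i j * a j)"

definition Lg :: "nat \<Rightarrow> (nat \<Rightarrow> 'a::complex_unital_banach_algebra) set" where
  "Lg m = {a \<in> tuples m. {(\<Sum>i<m. c i * a i) | c. True} = UNIV}"

definition GL :: "nat \<Rightarrow> (nat \<Rightarrow> nat \<Rightarrow> 'a::complex_unital_banach_algebra) set" where
  "GL m = {M \<in> matrices m. \<exists>N \<in> matrices m.
             matrix_times m M N = one_matrix m \<and> matrix_times m N M = one_matrix m}"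

definition GL0 :: "nat \<Rightarrow> (nat \<Rightarrow> nat \<Rightarrow> 'a::complex_unital_banach_algebra) set" where
  "GL0 m = connected_component_set (GL m) (one_matrix m)"

definition acts_transitively_on_Lg ::
  "nat \<Rightarrow> (nat \<Rightarrow> nat \<Rightarrow> 'a::complex_unital_banach_algebra) set \<Rightarrow> bool" where
  "acts_transitively_on_Lg m G \<longleftrightarrow> (\<forall>a \<in> Lg m. \<forall>b \<in> Lg m. \<exists>g \<in> G. matrix_act m g a = b)"

definition least_rank :: "(nat \<Rightarrow> bool) \<Rightarrow> enat" where
  "least_rank P =
     (if \<exists>n\<ge>1. \<forall>m\<ge>n. P m then enat (LEAST n. n \<ge> 1 \<and> (\<forall>m\<ge>n. P m)) else \<infinity>)"

definition csr :: "'a::complex_unital_banach_algebra itself \<Rightarrow> enat" where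
  "csr _ = least_rank (\<lambda>m. acts_transitively_on_Lg m (GL0 m :: (nat \<Rightarrow> nat \<Rightarrow> 'a) set))"

definition gsr :: "'a::complex_unital_banach_algebra itself \<Rightarrow> enat" where
  "gsr _ = least_rank (\<lambda>m. acts_transitively_on_Lg m (GL m :: (nat \<Rightarrow> nat \<Rightarrow> 'a) set))"

end

theory Submission
  imports Defs
begin

text \<open>
For each $m$ separately, the group $\mathrm{GL}_m$ (or its identity component) acts transitively on
$\mathrm{Lg}_m$ over $A$ if and only if it does so over $B$. The equality of the ranks follows, since
they depend only on the set of those $m$ for which the action is transitive.

The morphism reflects invertibility of elements, and this extends to matrices. Given a matrix $X$
over $A$ whose image is invertible, density provides $Y$ over $A$ such that the images of $XY$ and
$YX$ are close to the identity. A matrix with image close to the identity is invertible over $A$ by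
Gaussian elimination, because every pivot has an image close to $1$
(\<open>eventually_solvable_near_one\<close>, \<open>eventually_GL_near\<close>). Since segments near an invertible
matrix stay among the invertible matrices, approximants of a matrix in the identity component over
$B$ can be followed along that component and lie in the identity component over $A$
(\<open>eventually_GL0_approx\<close>). In the same way, a tuple over $A$ approximating a unimodular tuple over
$B$ is unimodular over $A$ (\<open>eventually_Lg\<close>).

Finally, orbits are open even when closeness is measured in $B$: if $\sum_j c_j a_j = 1$ and the image
of $x$ is close to that of $a$, then $1 + (x - a)c^T$ lies in the identity component over $A$ and
sends $a$ to $x$ (\<open>eventually_in_GL0_orbit\<close>). Hence a transforming matrix over $B$ may be replaced
by an approximant over $A$, the remaining error being corrected by a matrix close to the identity;
and every orbit over $B$ contains the image of a unimodular tuple over $A$, so that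
transitivity passes in both directions (\<open>acts_transitively_on_Lg_iff\<close>).
\<close>

section \<open>Inverses near the unit\<close>

text \<open>This is the Neumann series $v = u + u^2 + \dots$. It is obtained as a fixed point of a contraction,
once for each side, because the two fixed point equations $v = u + uv$ and $v = u + vu$ are exactly
what makes $1 + v$ a right or a left inverse of $1 - u$. The norm of $1$ does not enter the bound on
$v$, which matters because it need not be $1$.\<close>

lemma inverse_near_one:
  fixes u :: "'a::complex_unital_banach_algebra"
  assumes u: "norm u \<le> 1/2"
  shows "\<exists>v. (1 - u) * (1 + v) = 1 \<and> (1 + v) * (1 - u) = 1 \<and> norm v \<le> 2 * norm u"
proof -
  have contraction: "norm (u * z) \<le> 1/2 * norm z" "norm (z * u) \<le> 1/2 * norm z" for z
  proof -
    have "norm u * norm z \<le> 1/2 * norm z"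
      using u by (intro mult_right_mono) auto
    then show "norm (u * z) \<le> 1/2 * norm z" "norm (z * u) \<le> 1/2 * norm z"
      using norm_mult_ineq[of u z] norm_mult_ineq[of z u] by (simp_all add: mult.commute)
  qed
  have "\<exists>!v. u + u * v = v"
    by (rule banach_fix_type[of "1/2"])
      (use contraction(1) in \<open>auto simp: dist_norm right_diff_distrib[symmetric]\<close>)
  then obtain v where v: "u + u * v = v" by blast
  have "\<exists>!w. u + w * u = w"
    by (rule banach_fix_type[of "1/2"])
      (use contraction(2) in \<open>auto simp: dist_norm left_diff_distrib[symmetric]\<close>)
  then obtain w where w: "u + w * u = w" by blast
  have right: "(1 - u) * (1 + v) = 1"
    using v by (simp add: algebra_simps)
  have left: "(1 + w) * (1 - u) = 1"
    using w by (simp add: algebra_simps)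
  have "1 + w = (1 + w) * ((1 - u) * (1 + v))"
    by (simp add: right)
  also have "\<dots> = 1 + v"
    by (simp add: mult.assoc[symmetric] left)
  finally have "(1 + v) * (1 - u) = 1"
    using left by simp
  moreover have "norm v \<le> 2 * norm u"
    using norm_triangle_ineq[of u "u * v"] contraction(1)[of v] v by simp
  ultimately show ?thesis
    using right by blast
qed

section \<open>Matrices and the groups between the identity component and GL\<close>

lemma matrix_times_assoc:
  "matrix_times m (matrix_times m M N) P = matrix_times m M (matrix_times m N P)"
  unfolding matrix_times_def
  by (intro ext, simp add: sum_distrib_left sum_distrib_right mult.assoc, subst sum.swap, rule refl)

lemma matrix_act_times:
  "matrix_act m (matrix_times m M N) a = matrix_act m M (matrix_act m N a)"
  unfolding matrix_times_def matrix_act_def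
  by (intro ext, simp add: sum_distrib_left sum_distrib_right mult.assoc, subst sum.swap, rule refl)

lemma matrix_times_matrices:
  "M \<in> matrices m \<Longrightarrow> N \<in> matrices m \<Longrightarrow> matrix_times m M N \<in> matrices m"
  by (auto simp: matrices_def matrix_times_def)

lemma one_matrix_matrices: "one_matrix m \<in> matrices m"
  by (auto simp: matrices_def one_matrix_def)

lemma matrix_times_one:
  fixes M :: "nat \<Rightarrow> nat \<Rightarrow> 'a::complex_unital_banach_algebra"
  assumes "M \<in> matrices m"
  shows "matrix_times m (one_matrix m) M = M" "matrix_times m M (one_matrix m) = M"
proof -
  have "(\<Sum>k<m. (if i < m \<and> i = k then 1 else 0) * M k j) = M i j" for i j
  proof -
    have "(\<Sum>k<m. (if i < m \<and> i = k then 1 else 0) * M k j) = (\<Sum>k<m. if i = k then M i j else 0)"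
      by (intro sum.cong) auto
    then show ?thesis
      using assms by (auto simp: matrices_def)
  qed
  then show "matrix_times m (one_matrix m) M = M"
    by (auto simp: matrix_times_def one_matrix_def)
  have "(\<Sum>k<m. M i k * (if k < m \<and> k = j then 1 else 0)) = M i j" for i j
  proof -
    have "(\<Sum>k<m. M i k * (if k < m \<and> k = j then 1 else 0)) = (\<Sum>k<m. if j = k then M i j else 0)"
      by (intro sum.cong) auto
    then show ?thesis
      using assms by (auto simp: matrices_def)
  qed
  then show "matrix_times m M (one_matrix m) = M"
    by (auto simp: matrix_times_def one_matrix_def)
qed

lemma matrix_act_one:
  fixes a :: "nat \<Rightarrow> 'a::complex_unital_banach_algebra"
  assumes "a \<in> tuples m"
  shows "matrix_act m (one_matrix m) a = a"
proof
  fix i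
  have "matrix_act m (one_matrix m) a i = (\<Sum>k<m. if i = k then a i else 0)"
    unfolding matrix_act_def one_matrix_def by (intro sum.cong) auto
  then show "matrix_act m (one_matrix m) a i = a i"
    using assms by (auto simp: tuples_def)
qed

lemma matrix_act_tuples: "M \<in> matrices m \<Longrightarrow> matrix_act m M a \<in> tuples m"
  by (auto simp: matrices_def tuples_def matrix_act_def)

lemma GL_iff_one_sided_inverses:
  fixes M :: "nat \<Rightarrow> nat \<Rightarrow> 'a::complex_unital_banach_algebra"
  assumes M: "M \<in> matrices m" and R: "R \<in> matrices m" and L: "L \<in> matrices m"
    and MR: "matrix_times m M R = one_matrix m" and LM: "matrix_times m L M = one_matrix m"
  shows "M \<in> GL m"
proof -
  have "L = matrix_times m L (matrix_times m M R)"
    by (simp add: MR matrix_times_one L)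
  also have "\<dots> = R"
    by (simp add: matrix_times_assoc[symmetric] LM matrix_times_one R)
  finally show ?thesis
    using M R MR LM unfolding GL_def by blast
qed

lemma GL_matrices: "M \<in> GL m \<Longrightarrow> M \<in> matrices m"
  by (simp add: GL_def)

lemma one_matrix_GL: "one_matrix m \<in> GL m"
  using one_matrix_matrices matrix_times_one[OF one_matrix_matrices] unfolding GL_def by blast

lemma GL_inverse:
  assumes "M \<in> GL m"
  shows "\<exists>N\<in>GL m. matrix_times m M N = one_matrix m \<and> matrix_times m N M = one_matrix m"
  using assms unfolding GL_def by blast

lemma GL_times:
  fixes M :: "nat \<Rightarrow> nat \<Rightarrow> 'a::complex_unital_banach_algebra"
  assumes "M \<in> GL m" "N \<in> GL m"
  shows "matrix_times m M N \<in> GL m"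
proof -
  obtain M' N' where
    inv: "M' \<in> GL m" "matrix_times m M M' = one_matrix m" "matrix_times m M' M = one_matrix m"
      "N' \<in> GL m" "matrix_times m N N' = one_matrix m" "matrix_times m N' N = one_matrix m"
    using GL_inverse assms by metis
  have mat: "M \<in> matrices m" "N \<in> matrices m" "M' \<in> matrices m" "N' \<in> matrices m"
    using inv assms GL_matrices by blast+
  have "matrix_times m (matrix_times m M N) (matrix_times m N' M') =
      matrix_times m M (matrix_times m (matrix_times m N N') M')"
    by (simp add: matrix_times_assoc)
  moreover have "matrix_times m (matrix_times m N' M') (matrix_times m M N) =
      matrix_times m N' (matrix_times m (matrix_times m M' M) N)"
    by (simp add: matrix_times_assoc)
  ultimately show ?thesis
    using GL_iff_one_sided_inverses[of "matrix_times m M N" m "matrix_times m N' M'" "matrix_times m N' M'"]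
    by (simp add: inv matrix_times_one mat matrix_times_matrices)
qed

text \<open>The approximation arguments below produce an $N$ for which $MN$ and $NM$ are close to the identity,
hence invertible; they give no direct control of an inverse of $M$.\<close>

lemma GL_of_product_both_sides:
  fixes M N :: "nat \<Rightarrow> nat \<Rightarrow> 'a::complex_unital_banach_algebra"
  assumes M: "M \<in> matrices m" and N: "N \<in> matrices m"
    and MN: "matrix_times m M N \<in> GL m" and NM: "matrix_times m N M \<in> GL m"
  shows "M \<in> GL m"
proof -
  obtain R L where
    R: "R \<in> GL m" "matrix_times m (matrix_times m M N) R = one_matrix m" and
    L: "L \<in> GL m" "matrix_times m L (matrix_times m N M) = one_matrix m"
    using GL_inverse MN NM by metis
  show ?thesis
  proof (rule GL_iff_one_sided_inverses)
    show "matrix_times m M (matrix_times m N R) = one_matrix m"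
      "matrix_times m (matrix_times m L N) M = one_matrix m"
      using R L by (simp_all add: matrix_times_assoc)
  qed (use M N R L GL_matrices matrix_times_matrices in blast)+
qed

lemma continuous_on_matrix_times_left:
  fixes M :: "nat \<Rightarrow> nat \<Rightarrow> 'a::complex_unital_banach_algebra"
  shows "continuous_on S (\<lambda>X. matrix_times m M X)"
  unfolding matrix_times_def
  by (intro continuous_on_coordinatewise_then_product continuous_on_sum continuous_on_mult
      continuous_on_const)
    (metis continuous_on_product_coordinates continuous_on_product_then_coordinatewise continuous_on_subset subset_UNIV)

lemma GL0_subset_GL: "GL0 m \<subseteq> GL m"
  unfolding GL0_def by (rule connected_component_subset)

text \<open>Left translations alone make the identity component a group: translating by $M^{-1}$ moves the pair
$(1, M)$ to $(M^{-1}, 1)$. Continuity of inversion can thus be avoided.\<close>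

lemma connected_component_left_translate:
  assumes "G \<in> GL m" and "connected_component (GL m) M N"
  shows "connected_component (GL m) (matrix_times m G M) (matrix_times m G N)"
proof -
  obtain T where T: "connected T" "T \<subseteq> GL m" "M \<in> T" "N \<in> T"
    using assms(2) unfolding connected_component_def by blast
  have "connected (matrix_times m G ` T)"
    by (rule connected_continuous_image[OF continuous_on_matrix_times_left T(1)])
  moreover have "matrix_times m G ` T \<subseteq> GL m"
    using T(2) GL_times[OF assms(1)] by blast
  ultimately show ?thesis
    using T(3,4) unfolding connected_component_def by blast
qed

lemma GL0_times:
  assumes "M \<in> GL0 m" "N \<in> GL0 m"
  shows "matrix_times m M N \<in> GL0 m"
proof -
  have M: "M \<in> GL m"
    using assms(1) GL0_subset_GL by blast
  have "connected_component (GL m) (matrix_times m M (one_matrix m)) (matrix_times m M N)"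
    using connected_component_left_translate[OF M] assms(2) by (simp add: GL0_def)
  then show ?thesis
    using assms(1) connected_component_trans
    by (auto simp: GL0_def matrix_times_one[OF GL_matrices[OF M]])
qed

lemma GL0_inverse:
  assumes "M \<in> GL0 m"
  shows "\<exists>N\<in>GL0 m. matrix_times m M N = one_matrix m \<and> matrix_times m N M = one_matrix m"
proof -
  obtain N where N: "N \<in> GL m" "matrix_times m M N = one_matrix m" "matrix_times m N M = one_matrix m"
    using GL_inverse assms GL0_subset_GL by blast
  have "connected_component (GL m) (matrix_times m N (one_matrix m)) (matrix_times m N M)"
    using connected_component_left_translate[OF N(1)] assms by (simp add: GL0_def)
  then have "N \<in> GL0 m"
    using N by (simp add: GL0_def matrix_times_one[OF GL_matrices] connected_component_sym)
  then show ?thesis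
    using N by blast
qed

text \<open>One left combination equal to $1$ already generates the whole algebra as a left ideal.\<close>

lemma Lg_iff:
  fixes a :: "nat \<Rightarrow> 'a::complex_unital_banach_algebra"
  shows "a \<in> Lg m \<longleftrightarrow> a \<in> tuples m \<and> (\<exists>c. (\<Sum>i<m. c i * a i) = 1)"
proof -
  have "\<exists>d. z = (\<Sum>i<m. d i * a i)" if "(\<Sum>i<m. c i * a i) = 1" for c z
    using that by (intro exI[of _ "\<lambda>i. z * c i"]) (simp add: mult.assoc sum_distrib_left[symmetric])
  then have "(\<exists>c. (\<Sum>i<m. c i * a i) = 1) \<longleftrightarrow> {(\<Sum>i<m. c i * a i) | c. True} = UNIV"
    unfolding set_eq_iff by simp metis
  then show ?thesis
    unfolding Lg_def by simp
qed

text \<open>The connected and the general stable rank are treated by one argument, which uses only these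
properties of the acting group.\<close>

definition group_between_GL0_and_GL ::
  "nat \<Rightarrow> (nat \<Rightarrow> nat \<Rightarrow> 'a::complex_unital_banach_algebra) set \<Rightarrow> bool" where
  "group_between_GL0_and_GL m G \<longleftrightarrow> GL0 m \<subseteq> G \<and> G \<subseteq> GL m \<and>
     (\<forall>M\<in>G. \<forall>N\<in>G. matrix_times m M N \<in> G) \<and>
     (\<forall>M\<in>G. \<exists>N\<in>G. matrix_times m N M = one_matrix m)"

lemma group_between_GL0_and_GL_GL: "group_between_GL0_and_GL m (GL m)"
  unfolding group_between_GL0_and_GL_def using GL0_subset_GL GL_times GL_inverse by blast

lemma group_between_GL0_and_GL_GL0: "group_between_GL0_and_GL m (GL0 m)"
  unfolding group_between_GL0_and_GL_def using GL0_subset_GL GL0_times GL0_inverse by blast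

lemma same_orbit_through_common_point:
  fixes a b :: "nat \<Rightarrow> 'a::complex_unital_banach_algebra"
  assumes G: "group_between_GL0_and_GL m G" and g: "g \<in> G" and u: "u \<in> G" and b: "b \<in> tuples m"
    and eq: "matrix_act m u b = matrix_act m g a"
  shows "\<exists>h\<in>G. matrix_act m h a = b"
proof -
  obtain v where v: "v \<in> G" "matrix_times m v u = one_matrix m"
    using G u unfolding group_between_GL0_and_GL_def by blast
  have "matrix_act m (matrix_times m v g) a = matrix_act m (matrix_times m v u) b"
    by (simp add: matrix_act_times eq)
  also have "\<dots> = b"
    by (simp add: v matrix_act_one b)
  finally show ?thesis
    using G v(1) g unfolding group_between_GL0_and_GL_def by blast
qed

section \<open>Gaussian elimination\<close>

text \<open>Invertibility of a square matrix, expressed by the linear systems that it defines for columns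
and for rows. In this form the elimination step needs no formula for the inverse of a block matrix.\<close>

definition solvable_both_sides :: "nat \<Rightarrow> (nat \<Rightarrow> nat \<Rightarrow> 'a::semiring_0) \<Rightarrow> bool" where
  "solvable_both_sides m M \<longleftrightarrow>
     (\<forall>y. \<exists>x. \<forall>i<m. (\<Sum>j<m. M i j * x j) = y i) \<and>
     (\<forall>y. \<exists>x. \<forall>j<m. (\<Sum>i<m. x i * M i j) = y j)"

text \<open>Eliminating the last unknown by means of the invertible corner entry leaves a system for the Schur
complement of that entry.\<close>

lemma solvable_both_sides_if_Schur_complement:
  fixes M :: "nat \<Rightarrow> nat \<Rightarrow> 'a::complex_unital_banach_algebra"
  assumes p: "M m m * p = 1" "p * M m m = 1"
    and schur: "solvable_both_sides m (\<lambda>i j. M i j - M i m * p * M m j)"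
  shows "solvable_both_sides (Suc m) M"
proof -
  have "\<exists>z. \<forall>i<Suc m. (\<Sum>j<Suc m. M i j * z j) = y i" for y
  proof -
    obtain x where x: "\<forall>i<m. (\<Sum>j<m. (M i j - M i m * p * M m j) * x j) = y i - M i m * p * y m"
      using schur[unfolded solvable_both_sides_def, THEN conjunct1, rule_format,
          of "\<lambda>i. y i - M i m * p * y m"] by blast
    define r where "r = (\<Sum>j<m. M m j * x j)"
    \<comment> \<open>The last unknown is determined by the last equation.\<close>
    define z where "z = x(m := p * (y m - r))"
    have sum_z: "(\<Sum>j<Suc m. M i j * z j) = (\<Sum>j<m. M i j * x j) + M i m * (p * (y m - r))" for i
      by (simp add: z_def)
    have "(\<Sum>j<Suc m. M i j * z j) = y i" if "i < Suc m" for i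
    proof (cases "i = m")
      case True
      have "M m m * (p * (y m - r)) = y m - r"
        using p by (simp add: mult.assoc[symmetric])
      then show ?thesis
        unfolding sum_z by (simp add: True r_def)
    next
      case False
      have "(\<Sum>j<m. (M i j - M i m * p * M m j) * x j) = (\<Sum>j<m. M i j * x j) - M i m * p * r"
        by (simp add: r_def left_diff_distrib sum_subtractf sum_distrib_left mult.assoc)
      moreover have "i < m"
        using that False by simp
      ultimately have "(\<Sum>j<m. M i j * x j) - M i m * p * r = y i - M i m * p * y m"
        using x by simp
      then show ?thesis
        unfolding sum_z by (simp add: algebra_simps)
    qed
    then show ?thesis by blast
  qed
  moreover have "\<exists>z. \<forall>j<Suc m. (\<Sum>i<Suc m. z i * M i j) = y j" for y
  proof -
    obtain x where x: "\<forall>j<m. (\<Sum>i<m. x i * (M i j - M i m * p * M m j)) = y j - y m * p * M m j"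
      using schur[unfolded solvable_both_sides_def, THEN conjunct2, rule_format,
          of "\<lambda>j. y j - y m * p * M m j"] by blast
    define r where "r = (\<Sum>i<m. x i * M i m)"
    \<comment> \<open>The last unknown is determined by the last column.\<close>
    define z where "z = x(m := (y m - r) * p)"
    have sum_z: "(\<Sum>i<Suc m. z i * M i j) = (\<Sum>i<m. x i * M i j) + (y m - r) * p * M m j" for j
      by (simp add: z_def)
    have "(\<Sum>i<Suc m. z i * M i j) = y j" if "j < Suc m" for j
    proof (cases "j = m")
      case True
      have "(y m - r) * p * M m m = y m - r"
        using p by (simp add: mult.assoc)
      then show ?thesis
        unfolding sum_z by (simp add: True r_def)
    next
      case False
      have "(\<Sum>i<m. x i * (M i j - M i m * p * M m j)) = (\<Sum>i<m. x i * M i j) - r * p * M m j"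
        by (simp add: r_def right_diff_distrib sum_subtractf sum_distrib_right mult.assoc)
      moreover have "j < m"
        using that False by simp
      ultimately have "(\<Sum>i<m. x i * M i j) - r * p * M m j = y j - y m * p * M m j"
        using x by simp
      then show ?thesis
        unfolding sum_z by (simp add: algebra_simps)
    qed
    then show ?thesis by blast
  qed
  ultimately show ?thesis
    unfolding solvable_both_sides_def by blast
qed

lemma GL_if_solvable_both_sides:
  fixes M :: "nat \<Rightarrow> nat \<Rightarrow> 'a::complex_unital_banach_algebra"
  assumes M: "M \<in> matrices m" and solvable: "solvable_both_sides m M"
  shows "M \<in> GL m"
proof -
  have "\<exists>x. \<forall>i<m. (\<Sum>j<m. M i j * x j) = one_matrix m i k" for k
    using solvable[unfolded solvable_both_sides_def, THEN conjunct1, rule_format,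
        of "\<lambda>i. one_matrix m i k"] .
  then obtain r where r: "\<And>k. \<forall>i<m. (\<Sum>j<m. M i j * r k j) = one_matrix m i k"
    by metis
  have "\<exists>x. \<forall>j<m. (\<Sum>i<m. x i * M i j) = one_matrix m k j" for k
    using solvable[unfolded solvable_both_sides_def, THEN conjunct2, rule_format,
        of "\<lambda>j. one_matrix m k j"] .
  then obtain l where l: "\<And>k. \<forall>j<m. (\<Sum>i<m. l k i * M i j) = one_matrix m k j"
    by metis
  define R where "R = (\<lambda>j k. if j < m \<and> k < m then r k j else 0)"
  define L where "L = (\<lambda>k i. if k < m \<and> i < m then l k i else 0)"
  have zero: "M i j = 0" if "\<not> (i < m \<and> j < m)" for i j
    using M that by (auto simp: matrices_def)
  show ?thesis
  proof (rule GL_iff_one_sided_inverses)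
    show "R \<in> matrices m" "L \<in> matrices m"
      by (auto simp: matrices_def R_def L_def)
    have "matrix_times m M R i k = one_matrix m i k" for i k
    proof (cases "i < m \<and> k < m")
      case True
      then have "matrix_times m M R i k = (\<Sum>j<m. M i j * r k j)"
        unfolding matrix_times_def R_def by (intro sum.cong) auto
      with r True show ?thesis by simp
    next
      case False
      then show ?thesis
        by (auto simp: matrix_times_def R_def one_matrix_def zero)
    qed
    then show "matrix_times m M R = one_matrix m"
      by blast
    have "matrix_times m L M k j = one_matrix m k j" for k j
    proof (cases "k < m \<and> j < m")
      case True
      then have "matrix_times m L M k j = (\<Sum>i<m. l k i * M i j)"
        unfolding matrix_times_def L_def by (intro sum.cong) auto
      with l True show ?thesis by simp
    next
      case False
      then show ?thesis
        by (auto simp: matrix_times_def L_def one_matrix_def zero)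
    qed
    then show "matrix_times m L M = one_matrix m"
      by blast
  qed (rule M)
qed

section \<open>Dense spectral morphisms and limits of matrices\<close>

lemma tendsto_coordinatewise_iff:
  fixes f :: "'t \<Rightarrow> 'i \<Rightarrow> 'a::topological_space"
  shows "(f \<longlongrightarrow> l) F \<longleftrightarrow> (\<forall>i. ((\<lambda>t. f t i) \<longlongrightarrow> l i) F)"
  using limitin_componentwise[of "\<lambda>i. euclidean :: 'a topology" UNIV f l F]
  by (simp add: euclidean_product_topology)

text \<open>Removes the auxiliary index of an approximating sequence after a limit along both indices has been
taken.\<close>

lemma eventually_if_eventually_fst:
  assumes "\<forall>\<^sub>F p in F \<times>\<^sub>F G. P (fst p)" and "G \<noteq> bot"
  shows "\<forall>\<^sub>F t in F. P t"
  using assms(1) eventually_prod1[OF assms(2), where A = F and P = P] by (simp only: case_prod_unfold)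

text \<open>The hypotheses are stated for a morphism into another algebra, but the identity of an algebra
satisfies them as well; applied to it, the results below become statements about small
perturbations inside one algebra.

Closeness is always measured in the target: convergence means convergence of the images under the
morphism, along an arbitrary filter. The spectral property turns such information about images into
invertibility in the domain.\<close>

locale dense_spectral =
  fixes \<phi> :: "'a::complex_unital_banach_algebra \<Rightarrow> 'b::complex_unital_banach_algebra"
  assumes morphism: "unital_algebra_morphism \<phi>"
    and continuous: "continuous_on UNIV \<phi>"
    and dense: "dense_morphism \<phi>"
    and spectral: "spectral_morphism \<phi>"
begin

lemma map_add: "\<phi> (x + y) = \<phi> x + \<phi> y"
  and map_mult: "\<phi> (x * y) = \<phi> x * \<phi> y"
  and map_one: "\<phi> 1 = 1"
  and map_scaleC: "\<phi> (c *\<^sub>C x) = c *\<^sub>C \<phi> x"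
  using morphism by (simp_all add: unital_algebra_morphism_def)

lemma map_scaleR: "\<phi> (r *\<^sub>R x) = r *\<^sub>R \<phi> x"
  using map_scaleC[of "complex_of_real r" x] by (simp add: scaleC_of_real)

lemma map_zero: "\<phi> 0 = 0"
  using map_scaleR[of 0 0] by simp

lemma map_diff: "\<phi> (x - y) = \<phi> x - \<phi> y"
  using map_add[of "x - y" y] by (simp add: algebra_simps)

lemma map_sum: "\<phi> (sum f S) = (\<Sum>x\<in>S. \<phi> (f x))"
  by (induction S rule: infinite_finite_induct) (simp_all add: map_zero map_add)

lemma invertible_map_iff: "invertible_elem (\<phi> a) \<longleftrightarrow> invertible_elem a"
proof -
  have "(0::complex) *\<^sub>C (1::'a) = 0" "(0::complex) *\<^sub>C (1::'b) = 0"
    using scaleC_of_real[of 0 "1::'a"] scaleC_of_real[of 0 "1::'b"] by simp_all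
  moreover have "(0 \<in> spectrum (\<phi> a)) = (0 \<in> spectrum a)"
    using spectral by (simp add: spectral_morphism_def)
  ultimately show ?thesis
    by (simp add: spectrum_def)
qed

lemma map_matrices: "M \<in> matrices m \<Longrightarrow> (\<lambda>i j. \<phi> (M i j)) \<in> matrices m"
  by (simp add: matrices_def map_zero)

lemma map_one_matrix: "\<phi> (one_matrix m i j) = one_matrix m i j"
  by (simp add: one_matrix_def map_zero map_one)

lemma map_matrix_times:
  "\<phi> (matrix_times m M N i j) = matrix_times m (\<lambda>i j. \<phi> (M i j)) (\<lambda>i j. \<phi> (N i j)) i j"
  by (simp add: matrix_times_def map_sum map_mult)

lemma map_matrix_act:
  "\<phi> (matrix_act m M a i) = matrix_act m (\<lambda>i j. \<phi> (M i j)) (\<lambda>i. \<phi> (a i)) i"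
  by (simp add: matrix_act_def map_sum map_mult)

lemma map_GL:
  assumes "M \<in> GL m"
  shows "(\<lambda>i j. \<phi> (M i j)) \<in> GL m"
proof -
  obtain N where N: "N \<in> GL m" "matrix_times m M N = one_matrix m" "matrix_times m N M = one_matrix m"
    using GL_inverse[OF assms] by blast
  have "matrix_times m (\<lambda>i j. \<phi> (M i j)) (\<lambda>i j. \<phi> (N i j)) = one_matrix m"
    "matrix_times m (\<lambda>i j. \<phi> (N i j)) (\<lambda>i j. \<phi> (M i j)) = one_matrix m"
    using N by (auto simp: fun_eq_iff map_matrix_times[symmetric] map_one_matrix)
  then show ?thesis
    using map_matrices[OF GL_matrices[OF N(1)]] map_matrices[OF GL_matrices[OF assms]]
    unfolding GL_def by blast
qed

lemma map_GL0:
  assumes "M \<in> GL0 m"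
  shows "(\<lambda>i j. \<phi> (M i j)) \<in> GL0 m"
proof -
  let ?\<Phi> = "\<lambda>M i j. \<phi> (M i j)"
  obtain T where T: "connected T" "T \<subseteq> GL m" "one_matrix m \<in> T" "M \<in> T"
    using assms unfolding GL0_def connected_component_def by auto
  have "continuous_on T (\<lambda>M. \<phi> (M i j))" for i j
  proof (rule continuous_on_compose2[OF continuous])
    show "continuous_on T (\<lambda>M. M i j)"
      by (metis continuous_on_product_coordinates continuous_on_product_then_coordinatewise
          continuous_on_subset subset_UNIV)
  qed simp
  then have "continuous_on T ?\<Phi>"
    by (intro continuous_on_coordinatewise_then_product)
  then have "connected (?\<Phi> ` T)"
    using T(1) by (rule connected_continuous_image)
  moreover have "?\<Phi> ` T \<subseteq> GL m"
    using T(2) map_GL by blast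
  moreover have "one_matrix m \<in> ?\<Phi> ` T" "?\<Phi> M \<in> ?\<Phi> ` T"
    using imageI[OF T(3), of ?\<Phi>] T(4) by (simp_all add: map_one_matrix)
  ultimately show ?thesis
    unfolding GL0_def connected_component_def by blast
qed

lemma map_Lg:
  assumes "a \<in> Lg m"
  shows "(\<lambda>i. \<phi> (a i)) \<in> Lg m"
proof -
  obtain c where c: "(\<Sum>i<m. c i * a i) = 1" and a: "a \<in> tuples m"
    using assms by (auto simp: Lg_iff)
  have "\<phi> (\<Sum>i<m. c i * a i) = 1"
    by (simp only: c map_one)
  then have "(\<Sum>i<m. \<phi> (c i) * \<phi> (a i)) = 1"
    by (simp add: map_sum map_mult)
  moreover have "(\<lambda>i. \<phi> (a i)) \<in> tuples m"
    using a by (simp add: tuples_def map_zero)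
  ultimately show ?thesis
    unfolding Lg_iff by (intro conjI exI[of _ "\<lambda>i. \<phi> (c i)"])
qed

text \<open>The inverses exist in the domain by the spectral property. Their images converge to $1$ by the
bound of the Neumann series, which lets the elimination below continue with a Schur complement whose
image is again close to the identity.\<close>

lemma eventually_inverse:
  assumes a: "((\<lambda>t. \<phi> (a t)) \<longlongrightarrow> 1) F"
  obtains a' where "\<forall>\<^sub>F t in F. a t * a' t = 1 \<and> a' t * a t = 1" "((\<lambda>t. \<phi> (a' t)) \<longlongrightarrow> 1) F"
proof -
  define a' where "a' = (\<lambda>t. SOME y. a t * y = 1 \<and> y * a t = 1)"
  have "\<forall>\<^sub>F t in F. dist (\<phi> (a t)) 1 < 1/2"
    using a by (rule tendstoD) simp
  then have ev: "\<forall>\<^sub>F t in F. (a t * a' t = 1 \<and> a' t * a t = 1)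
      \<and> norm (\<phi> (a' t) - 1) \<le> 2 * norm (\<phi> (a t) - 1)"
  proof eventually_elim
    case (elim t)
    then have "norm (1 - \<phi> (a t)) \<le> 1/2"
      by (simp add: dist_norm norm_minus_commute)
    from inverse_near_one[OF this] obtain v where
      v: "\<phi> (a t) * (1 + v) = 1" "(1 + v) * \<phi> (a t) = 1" "norm v \<le> 2 * norm (1 - \<phi> (a t))"
      by auto
    then have "invertible_elem (a t)"
      unfolding invertible_map_iff[symmetric] invertible_elem_def by blast
    then have inv: "a t * a' t = 1 \<and> a' t * a t = 1"
      unfolding a'_def invertible_elem_def by (rule someI_ex)
    then have "\<phi> (a' t) * \<phi> (a t) = 1"
      by (metis map_mult map_one)
    then have "\<phi> (a' t) = 1 + v"
      by (metis mult.assoc mult_1_left mult_1_right v(1))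
    then show ?case
      using v(3) inv by (simp add: norm_minus_commute)
  qed
  have "((\<lambda>t. 2 * norm (\<phi> (a t) - 1)) \<longlongrightarrow> 2 * 0) F"
    by (rule tendsto_mult_left[OF tendsto_norm_zero[OF LIM_zero[OF a]]])
  moreover have "\<forall>\<^sub>F t in F. norm (\<phi> (a' t) - 1) \<le> 2 * norm (\<phi> (a t) - 1)"
    using ev by eventually_elim blast
  ultimately have "((\<lambda>t. \<phi> (a' t) - 1) \<longlongrightarrow> 0) F"
    using Lim_null_comparison[of "\<lambda>t. \<phi> (a' t) - 1" "\<lambda>t. 2 * norm (\<phi> (a t) - 1)" F] by simp
  then have "((\<lambda>t. \<phi> (a' t)) \<longlongrightarrow> 1) F"
    by (simp add: LIM_zero_iff)
  moreover have "\<forall>\<^sub>F t in F. a t * a' t = 1 \<and> a' t * a t = 1"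
    using ev by eventually_elim blast
  ultimately show ?thesis
    using that by blast
qed

text \<open>This is where invertibility passes from elements to matrices. In Gaussian elimination all pivots have
images close to $1$ and so are invertible in the domain.\<close>

lemma eventually_solvable_near_one:
  fixes X :: "'t \<Rightarrow> nat \<Rightarrow> nat \<Rightarrow> 'a"
  assumes "\<forall>i<m. \<forall>j<m. ((\<lambda>t. \<phi> (X t i j)) \<longlongrightarrow> (if i = j then 1 else 0)) F"
  shows "\<forall>\<^sub>F t in F. solvable_both_sides m (X t)"
  using assms
proof (induction m arbitrary: X)
  case 0
  show ?case by (simp add: solvable_both_sides_def)
next
  case (Suc m)
  have "((\<lambda>t. \<phi> (X t m m)) \<longlongrightarrow> 1) F"
    using Suc.prems by force
  then obtain p where
    p: "\<forall>\<^sub>F t in F. X t m m * p t = 1 \<and> p t * X t m m = 1" and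
    p_lim: "((\<lambda>t. \<phi> (p t)) \<longlongrightarrow> 1) F"
    by (rule eventually_inverse)
  define S where "S = (\<lambda>t i j. X t i j - X t i m * p t * X t m j)"
  have "((\<lambda>t. \<phi> (S t i j)) \<longlongrightarrow> (if i = j then 1 else 0)) F" if "i < m" "j < m" for i j
  proof -
    have "((\<lambda>t. \<phi> (X t i m)) \<longlongrightarrow> 0) F" "((\<lambda>t. \<phi> (X t m j)) \<longlongrightarrow> 0) F"
      using Suc.prems[rule_format, of i m] Suc.prems[rule_format, of m j] that by simp_all
    moreover have "((\<lambda>t. \<phi> (X t i j)) \<longlongrightarrow> (if i = j then 1 else 0)) F"
      using Suc.prems that by simp
    ultimately have "((\<lambda>t. \<phi> (X t i j) - \<phi> (X t i m) * \<phi> (p t) * \<phi> (X t m j))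
        \<longlongrightarrow> (if i = j then 1 else 0) - 0 * 1 * 0) F"
      using p_lim by (intro tendsto_diff tendsto_mult)
    then show ?thesis
      by (simp add: S_def map_diff map_mult)
  qed
  then have "\<forall>\<^sub>F t in F. solvable_both_sides m (S t)"
    by (intro Suc.IH) blast
  with p show ?case
  proof eventually_elim
    case (elim t)
    then show ?case
      by (intro solvable_both_sides_if_Schur_complement[of "X t" m "p t"]) (simp_all add: S_def)
  qed
qed

lemma eventually_GL_near_one:
  assumes mat: "\<forall>\<^sub>F t in F. X t \<in> matrices m"
    and lim: "\<And>i j. ((\<lambda>t. \<phi> (X t i j)) \<longlongrightarrow> one_matrix m i j) F"
  shows "\<forall>\<^sub>F t in F. X t \<in> GL m"
proof -
  have "((\<lambda>t. \<phi> (X t i j)) \<longlongrightarrow> (if i = j then 1 else 0)) F" if "i < m" "j < m" for i j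
    using lim[of i j] that by (simp add: one_matrix_def)
  then have "\<forall>\<^sub>F t in F. solvable_both_sides m (X t)"
    by (intro eventually_solvable_near_one) blast
  with mat show ?thesis
  proof eventually_elim
    case (elim t)
    then show ?case
      by (rule GL_if_solvable_both_sides)
  qed
qed

section \<open>Approximation of the target\<close>

text \<open>The element $0$ is approximated by the zero sequence, so that entrywise approximation preserves the vanishing of a
tuple or a matrix outside its index range.\<close>

definition approx :: "'b \<Rightarrow> nat \<Rightarrow> 'a" where
  "approx b = (if b = 0 then (\<lambda>_. 0) else (SOME x. (\<lambda>n. \<phi> (x n)) \<longlonglongrightarrow> b))"

lemma approx_zero: "approx 0 n = 0"
  by (simp add: approx_def)

lemma approx_lim: "(\<lambda>n. \<phi> (approx b n)) \<longlonglongrightarrow> b"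
proof (cases "b = 0")
  case True
  then show ?thesis by (simp add: approx_def map_zero)
next
  case False
  have "b \<in> closure (range \<phi>)"
    using dense by (simp add: dense_morphism_def)
  then obtain y where y: "\<forall>n. y n \<in> range \<phi>" "y \<longlonglongrightarrow> b"
    unfolding closure_sequential by blast
  then have "\<forall>n. \<exists>x. y n = \<phi> x"
    by blast
  then obtain x where "\<forall>n. y n = \<phi> (x n)"
    by metis
  then have "y = (\<lambda>n. \<phi> (x n))"
    by blast
  with y(2) have "(\<lambda>n. \<phi> (x n)) \<longlonglongrightarrow> b"
    by simp
  then have "\<exists>x. (\<lambda>n. \<phi> (x n)) \<longlonglongrightarrow> b"
    by (rule exI[where x = x])
  then have "(\<lambda>n. \<phi> ((SOME x. (\<lambda>n. \<phi> (x n)) \<longlonglongrightarrow> b) n)) \<longlonglongrightarrow> b"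
    by (rule someI_ex[where P = "\<lambda>x. (\<lambda>n. \<phi> (x n)) \<longlonglongrightarrow> b"])
  then show ?thesis
    using False by (simp add: approx_def)
qed

lemma approx_tuples: "b \<in> tuples m \<Longrightarrow> (\<lambda>i. approx (b i) n) \<in> tuples m"
  by (simp add: tuples_def approx_zero)

lemma approx_matrices: "M \<in> matrices m \<Longrightarrow> (\<lambda>i j. approx (M i j) n) \<in> matrices m"
  by (simp add: matrices_def approx_zero)

section \<open>Lifting invertible matrices and their components\<close>

lemma eventually_GL_near_one_product:
  assumes X: "\<forall>\<^sub>F t in F. X t \<in> matrices m" "\<And>i j. ((\<lambda>t. \<phi> (X t i j)) \<longlongrightarrow> G i j) F"
    and Y: "\<forall>\<^sub>F t in F. Y t \<in> matrices m" "\<And>i j. ((\<lambda>t. \<phi> (Y t i j)) \<longlongrightarrow> H i j) F"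
    and GH: "matrix_times m G H = one_matrix m"
  shows "\<forall>\<^sub>F t in F. matrix_times m (X t) (Y t) \<in> GL m"
proof (rule eventually_GL_near_one)
  show "\<forall>\<^sub>F t in F. matrix_times m (X t) (Y t) \<in> matrices m"
    using X(1) Y(1) by eventually_elim (rule matrix_times_matrices)
  fix i j
  have "((\<lambda>t. \<Sum>k<m. \<phi> (X t i k) * \<phi> (Y t k j)) \<longlongrightarrow> (\<Sum>k<m. G i k * H k j)) F"
    by (intro tendsto_sum tendsto_mult X Y)
  moreover have "(\<Sum>k<m. G i k * H k j) = one_matrix m i j"
    using fun_cong[OF fun_cong[OF GH, of i], of j] by (simp add: matrix_times_def)
  ultimately show "((\<lambda>t. \<phi> (matrix_times m (X t) (Y t) i j)) \<longlongrightarrow> one_matrix m i j) F"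
    by (simp add: matrix_times_def map_sum map_mult)
qed

text \<open>If the images of $X_t$ tend to $G$ and those of $Y_n$ tend to $G^{-1}$, then the images of $X_t Y_n$
and $Y_n X_t$ tend to the identity. The index $n$ is independent of $t$, so the limit is taken along
the product filter. For the identity morphism this says that the invertible matrices are open.\<close>

lemma eventually_GL_near:
  fixes X :: "'t \<Rightarrow> nat \<Rightarrow> nat \<Rightarrow> 'a"
  assumes G: "G \<in> GL m" and mat: "\<forall>\<^sub>F t in F. X t \<in> matrices m"
    and lim: "\<And>i j. ((\<lambda>t. \<phi> (X t i j)) \<longlongrightarrow> G i j) F"
  shows "\<forall>\<^sub>F t in F. X t \<in> GL m"
proof -
  obtain H where H: "H \<in> GL m" "matrix_times m G H = one_matrix m" "matrix_times m H G = one_matrix m"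
    using GL_inverse[OF G] by blast
  let ?F = "F \<times>\<^sub>F sequentially"
  define X' where "X' = (\<lambda>p :: 't \<times> nat. X (fst p))"
  define Y where "Y = (\<lambda>(p :: 't \<times> nat) i j. approx (H i j) (snd p))"
  have X': "\<forall>\<^sub>F p in ?F. X' p \<in> matrices m"
    unfolding X'_def by (rule eventually_compose_filterlim[OF mat filterlim_fst])
  have X'_lim: "((\<lambda>p. \<phi> (X' p i j)) \<longlongrightarrow> G i j) ?F" for i j
    unfolding X'_def by (rule filterlim_compose[OF lim filterlim_fst])
  have Y: "\<forall>\<^sub>F p in ?F. Y p \<in> matrices m"
    unfolding Y_def by (intro always_eventually allI approx_matrices GL_matrices H)
  have Y_lim: "((\<lambda>p. \<phi> (Y p i j)) \<longlongrightarrow> H i j) ?F" for i j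
    unfolding Y_def by (rule filterlim_compose[OF approx_lim filterlim_snd])
  have "\<forall>\<^sub>F p in ?F. matrix_times m (X' p) (Y p) \<in> GL m"
    by (rule eventually_GL_near_one_product[OF X' X'_lim Y Y_lim H(2)])
  moreover have "\<forall>\<^sub>F p in ?F. matrix_times m (Y p) (X' p) \<in> GL m"
    by (rule eventually_GL_near_one_product[OF Y Y_lim X' X'_lim H(3)])
  ultimately have "\<forall>\<^sub>F p in ?F. X' p \<in> GL m"
    using X' Y by eventually_elim (rule GL_of_product_both_sides)
  then show ?thesis
    unfolding X'_def by (rule eventually_if_eventually_fst) (rule sequentially_bot)
qed

text \<open>The whole segment from $X_t$ to $Z_t$ has images close to $G$, so it consists of invertible
matrices. The parameter of the segment is made part of the index: uniformity over the
segment is convergence along the product with the principal filter on $[0,1]$.\<close>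

lemma eventually_same_component:
  assumes G: "G \<in> GL m"
    and X: "\<forall>\<^sub>F t in F. X t \<in> matrices m" "\<And>i j. ((\<lambda>t. \<phi> (X t i j)) \<longlongrightarrow> G i j) F"
    and Z: "\<forall>\<^sub>F t in F. Z t \<in> matrices m" "\<And>i j. ((\<lambda>t. \<phi> (Z t i j)) \<longlongrightarrow> G i j) F"
  shows "\<forall>\<^sub>F t in F. connected_component (GL m) (X t) (Z t)"
proof -
  let ?F = "F \<times>\<^sub>F principal {0..1::real}"
  define W where "W = (\<lambda>p i j. X (fst p) i j + snd p *\<^sub>R (Z (fst p) i j - X (fst p) i j))"
  have snd: "\<forall>\<^sub>F p in ?F. snd p \<in> {0..1}"
    by (rule eventually_compose_filterlim[OF _ filterlim_snd]) (simp add: eventually_principal)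
  have "\<forall>\<^sub>F p in ?F. X (fst p) \<in> matrices m" "\<forall>\<^sub>F p in ?F. Z (fst p) \<in> matrices m"
    by (rule eventually_compose_filterlim[OF X(1) filterlim_fst],
        rule eventually_compose_filterlim[OF Z(1) filterlim_fst])
  then have W: "\<forall>\<^sub>F p in ?F. W p \<in> matrices m"
    by eventually_elim (auto simp: W_def matrices_def)
  have W_lim: "((\<lambda>p. \<phi> (W p i j)) \<longlongrightarrow> G i j) ?F" for i j
  proof -
    let ?d = "\<lambda>p. \<phi> (Z (fst p) i j) - \<phi> (X (fst p) i j)"
    have lim: "((\<lambda>p. \<phi> (X (fst p) i j)) \<longlongrightarrow> G i j) ?F" "((\<lambda>p. \<phi> (Z (fst p) i j)) \<longlongrightarrow> G i j) ?F"
      by (rule filterlim_compose[OF X(2) filterlim_fst], rule filterlim_compose[OF Z(2) filterlim_fst])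
    then have "(?d \<longlongrightarrow> G i j - G i j) ?F"
      by (intro tendsto_diff)
    then have "((\<lambda>p. norm (?d p)) \<longlongrightarrow> 0) ?F"
      by (simp add: tendsto_norm_zero)
    moreover have "\<forall>\<^sub>F p in ?F. norm (snd p *\<^sub>R ?d p) \<le> norm (?d p)"
      using snd by eventually_elim (simp add: mult_left_le_one_le)
    ultimately have "((\<lambda>p. snd p *\<^sub>R ?d p) \<longlongrightarrow> 0) ?F"
      using Lim_null_comparison[of "\<lambda>p. snd p *\<^sub>R ?d p" "\<lambda>p. norm (?d p)" ?F] by blast
    then have "((\<lambda>p. \<phi> (X (fst p) i j) + snd p *\<^sub>R ?d p) \<longlongrightarrow> G i j + 0) ?F"
      using lim(1) by (intro tendsto_add)
    then show ?thesis
      by (simp add: W_def map_add map_scaleR map_diff)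
  qed
  have "\<forall>\<^sub>F p in ?F. W p \<in> GL m"
    by (rule eventually_GL_near[OF G W W_lim])
  then obtain P Q where PQ: "eventually P F" "eventually Q (principal {0..1})"
    "\<And>t s. P t \<Longrightarrow> Q s \<Longrightarrow> W (t, s) \<in> GL m"
    unfolding eventually_prod_filter by blast
  have "connected_component (GL m) (X t) (Z t)" if "P t" for t
  proof -
    let ?S = "(\<lambda>s. W (t, s)) ` {0..1}"
    have "continuous_on {0..1} (\<lambda>s. W (t, s))"
      unfolding W_def fst_conv snd_conv
      by (intro continuous_on_coordinatewise_then_product continuous_intros)
    then have "connected ?S"
      by (rule connected_continuous_image) simp
    moreover have "?S \<subseteq> GL m"
      using PQ(2,3) that by (auto simp: eventually_principal)
    moreover have "W (t, 0) \<in> ?S" "W (t, 1) \<in> ?S"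
      by simp_all
    moreover have "W (t, 0) = X t" "W (t, 1) = Z t"
      by (simp_all add: W_def)
    ultimately show ?thesis
      unfolding connected_component_def by metis
  qed
  with PQ(1) show ?thesis
    by (rule eventually_mono)
qed

lemma eventually_GL0_near_one:
  assumes "\<forall>\<^sub>F t in F. X t \<in> matrices m" "\<And>i j. ((\<lambda>t. \<phi> (X t i j)) \<longlongrightarrow> one_matrix m i j) F"
  shows "\<forall>\<^sub>F t in F. X t \<in> GL0 m"
proof -
  have "\<forall>\<^sub>F t in F. connected_component (GL m) (one_matrix m) (X t)"
    by (rule eventually_same_component[OF one_matrix_GL])
      (simp_all add: assms map_one_matrix one_matrix_matrices)
  then show ?thesis
    by (simp add: GL0_def)
qed

text \<open>Taking for the index filter the one generated by the preimages of the neighbourhoods of $G$ turns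
the statement about limits into one about a single neighbourhood.\<close>

lemma same_component_near:
  assumes G: "G \<in> GL m"
  shows "\<exists>U. open U \<and> G \<in> U \<and> (\<forall>X\<in>matrices m. \<forall>Z\<in>matrices m.
    (\<lambda>i j. \<phi> (X i j)) \<in> U \<longrightarrow> (\<lambda>i j. \<phi> (Z i j)) \<in> U \<longrightarrow> connected_component (GL m) X Z)"
proof -
  let ?\<Phi> = "\<lambda>X i j. \<phi> (X i j)"
  let ?F = "inf (filtercomap ?\<Phi> (nhds G)) (principal (matrices m))"
  have mat: "\<forall>\<^sub>F X in ?F. X \<in> matrices m"
    by (simp add: eventually_inf_principal)
  have "filterlim ?\<Phi> (nhds G) ?F"
    by (rule filterlim_mono[OF filterlim_filtercomap]) auto
  then have lim: "((\<lambda>X. \<phi> (X i j)) \<longlongrightarrow> G i j) ?F" for i j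
    by (simp add: tendsto_coordinatewise_iff)
  have "\<forall>\<^sub>F p in ?F \<times>\<^sub>F ?F. connected_component (GL m) (fst p) (snd p)"
    by (rule eventually_same_component[OF G])
      (rule eventually_compose_filterlim[OF mat filterlim_fst] filterlim_compose[OF lim filterlim_fst]
        eventually_compose_filterlim[OF mat filterlim_snd] filterlim_compose[OF lim filterlim_snd])+
  then obtain Q where Q: "eventually Q ?F" "\<And>X Z. Q X \<Longrightarrow> Q Z \<Longrightarrow> connected_component (GL m) X Z"
    unfolding eventually_prod_same by auto
  from Q(1) obtain U where "open U" "G \<in> U" "\<And>X. ?\<Phi> X \<in> U \<Longrightarrow> X \<in> matrices m \<Longrightarrow> Q X"
    unfolding eventually_inf_principal eventually_filtercomap_nhds by blast
  with Q(2) show ?thesis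
    by blast
qed

text \<open>A matrix in the identity component over the target is approximated by the identity component
over the domain. Near a given invertible matrix, approximants of different matrices lie in one
common component, so the property is locally constant, and it holds at the identity.\<close>

lemma eventually_GL0_approx:
  assumes g: "g \<in> GL0 m"
  shows "\<forall>\<^sub>F n in sequentially. (\<lambda>i j. approx (g i j) n) \<in> GL0 m"
proof -
  let ?P = "\<lambda>g. \<forall>\<^sub>F n in sequentially. (\<lambda>i j. approx (g i j) n) \<in> GL0 m"
  obtain T where T: "connected T" "T \<subseteq> GL m" "one_matrix m \<in> T" "g \<in> T"
    using g unfolding GL0_def connected_component_def by auto
  show "?P g"
  proof (rule connected_induction_simple[OF T(1,3,4), of ?P])
    show "?P (one_matrix m)"
    proof (rule eventually_GL0_near_one)
      show "\<forall>\<^sub>F n in sequentially. (\<lambda>i j. approx (one_matrix m i j) n) \<in> matrices m"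
        using approx_matrices[OF one_matrix_matrices] by simp
    qed (rule approx_lim)
    fix g0 assume "g0 \<in> T"
    then have "g0 \<in> GL m"
      using T(2) by blast
    from same_component_near[OF this] obtain U where U: "open U" "g0 \<in> U"
      "\<And>X Z. X \<in> matrices m \<Longrightarrow> Z \<in> matrices m \<Longrightarrow> (\<lambda>i j. \<phi> (X i j)) \<in> U \<Longrightarrow>
        (\<lambda>i j. \<phi> (Z i j)) \<in> U \<Longrightarrow> connected_component (GL m) X Z"
      by blast
    have near: "\<forall>\<^sub>F n in sequentially. (\<lambda>i j. \<phi> (approx (h i j) n)) \<in> U" if "h \<in> U" for h
    proof -
      have "(\<lambda>n i j. \<phi> (approx (h i j) n)) \<longlonglongrightarrow> h"
        by (simp add: tendsto_coordinatewise_iff approx_lim)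
      then show ?thesis
        using U(1) that by (rule topological_tendstoD)
    qed
    have locally_constant: "?P k" if "h \<in> T \<inter> U" "k \<in> T \<inter> U" "?P h" for h k
    proof -
      have mat: "h \<in> matrices m" "k \<in> matrices m"
        using that T(2) GL_matrices by blast+
      have "\<forall>\<^sub>F n in sequentially. (\<lambda>i j. \<phi> (approx (h i j) n)) \<in> U"
        "\<forall>\<^sub>F n in sequentially. (\<lambda>i j. \<phi> (approx (k i j) n)) \<in> U"
        using near[of h] near[of k] that by simp_all
      with that(3) show ?thesis
      proof eventually_elim
        case (elim n)
        then have "connected_component (GL m) (\<lambda>i j. approx (h i j) n) (\<lambda>i j. approx (k i j) n)"
          by (intro U(3) approx_matrices mat)
        with elim(1) show ?case
          unfolding GL0_def mem_Collect_eq by (rule connected_component_trans)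
      qed
    qed
    show "\<exists>V. openin (top_of_set T) V \<and> g0 \<in> V \<and> (\<forall>h\<in>V. \<forall>k\<in>V. ?P h \<longrightarrow> ?P k)"
    proof (intro exI conjI ballI impI)
      show "openin (top_of_set T) (T \<inter> U)"
        using U(1) by (rule openin_open_Int)
      show "g0 \<in> T \<inter> U"
        using U(2) \<open>g0 \<in> T\<close> by blast
    qed (rule locally_constant)
  qed
qed

lemma eventually_GL_approx:
  assumes "g \<in> GL m"
  shows "\<forall>\<^sub>F n in sequentially. (\<lambda>i j. approx (g i j) n) \<in> GL m"
proof (rule eventually_GL_near[OF assms])
  show "\<forall>\<^sub>F n in sequentially. (\<lambda>i j. approx (g i j) n) \<in> matrices m"
    using approx_matrices[OF GL_matrices[OF assms]] by simp
qed (rule approx_lim)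

section \<open>Lifting unimodular tuples and their orbits\<close>

text \<open>If $\sum_i c_i b_i = 1$, then the images of approximants of $\sum_i c_i x_i$ tend to $1$; such
elements are invertible in the domain, and a left multiple of the combination equals $1$.\<close>

lemma eventually_Lg:
  assumes b: "b \<in> Lg m" and x: "\<forall>\<^sub>F t in F. x t \<in> tuples m"
    and lim: "\<And>i. ((\<lambda>t. \<phi> (x t i)) \<longlongrightarrow> b i) F"
  shows "\<forall>\<^sub>F t in F. x t \<in> Lg m"
proof -
  obtain c where c: "(\<Sum>i<m. c i * b i) = 1"
    using b by (auto simp: Lg_iff)
  let ?F = "F \<times>\<^sub>F sequentially"
  define w where "w = (\<lambda>p. \<Sum>i<m. approx (c i) (snd p) * x (fst p) i)"
  have "((\<lambda>p. \<Sum>i<m. \<phi> (approx (c i) (snd p)) * \<phi> (x (fst p) i)) \<longlongrightarrow> (\<Sum>i<m. c i * b i)) ?F"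
    by (intro tendsto_sum tendsto_mult filterlim_compose[OF approx_lim filterlim_snd]
        filterlim_compose[OF lim filterlim_fst])
  then have "((\<lambda>p. \<phi> (w p)) \<longlongrightarrow> 1) ?F"
    by (simp add: w_def map_sum map_mult c)
  then obtain w' where w': "\<forall>\<^sub>F p in ?F. w p * w' p = 1 \<and> w' p * w p = 1"
    by (rule eventually_inverse)
  moreover have "\<forall>\<^sub>F p in ?F. x (fst p) \<in> tuples m"
    by (rule eventually_compose_filterlim[OF x filterlim_fst])
  ultimately have "\<forall>\<^sub>F p in ?F. x (fst p) \<in> Lg m"
  proof eventually_elim
    case (elim p)
    then have "(\<Sum>i<m. (w' p * approx (c i) (snd p)) * x (fst p) i) = 1"
      by (simp add: w_def sum_distrib_left mult.assoc)
    with elim(2) show ?case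
      unfolding Lg_iff by (intro conjI exI[of _ "\<lambda>i. w' p * approx (c i) (snd p)"])
  qed
  then show ?thesis
    by (rule eventually_if_eventually_fst) (rule sequentially_bot)
qed

text \<open>If $\sum_j c_j a_j = 1$, then the matrix $u = 1 + (x - a)c^T$ sends $a$ to $x$, and its image is
close to the identity as soon as the image of $x$ is close to that of $a$.\<close>

lemma eventually_in_GL0_orbit:
  assumes a: "a \<in> Lg m" and x: "\<forall>\<^sub>F t in F. x t \<in> tuples m"
    and lim: "\<And>i. ((\<lambda>t. \<phi> (x t i)) \<longlongrightarrow> \<phi> (a i)) F"
  shows "\<forall>\<^sub>F t in F. \<exists>u\<in>GL0 m. matrix_act m u a = x t"
proof -
  obtain c where c: "(\<Sum>i<m. c i * a i) = 1" and a_tuple: "a \<in> tuples m"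
    using a by (auto simp: Lg_iff)
  \<comment> \<open>Cutting off the coefficients at the index m makes the entries of u vanish outside the m by m square.\<close>
  define u where "u = (\<lambda>t i j. one_matrix m i j + (x t i - a i) * (if j < m then c j else 0))"
  have "\<forall>\<^sub>F t in F. u t \<in> matrices m"
    using x by eventually_elim
      (use a_tuple in \<open>auto simp: u_def matrices_def tuples_def one_matrix_def\<close>)
  moreover have "((\<lambda>t. \<phi> (u t i j)) \<longlongrightarrow> one_matrix m i j) F" for i j
  proof -
    have "((\<lambda>t. one_matrix m i j + (\<phi> (x t i) - \<phi> (a i)) * \<phi> (if j < m then c j else 0))
        \<longlongrightarrow> one_matrix m i j + (\<phi> (a i) - \<phi> (a i)) * \<phi> (if j < m then c j else 0)) F"
      by (intro tendsto_add tendsto_mult tendsto_diff tendsto_const lim)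
    then show ?thesis
      by (simp add: u_def map_add map_mult map_diff map_one_matrix)
  qed
  ultimately have u: "\<forall>\<^sub>F t in F. u t \<in> GL0 m"
    by (rule eventually_GL0_near_one)
  have act: "matrix_act m (u t) a = x t" for t
  proof
    fix i
    have "matrix_act m (u t) a i = (\<Sum>j<m. one_matrix m i j * a j) + (x t i - a i) * (\<Sum>j<m. c j * a j)"
      unfolding matrix_act_def u_def
      by (simp add: distrib_right sum.distrib sum_distrib_left mult.assoc)
    also have "(\<Sum>j<m. one_matrix m i j * a j) = a i"
      using fun_cong[OF matrix_act_one[OF a_tuple], of i] by (simp add: matrix_act_def)
    finally show "matrix_act m (u t) a i = x t i"
      by (simp add: c)
  qed
  from u show ?thesis
  proof (rule eventually_mono)
    fix t assume "u t \<in> GL0 m"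
    with act show "\<exists>u\<in>GL0 m. matrix_act m u a = x t" by blast
  qed
qed

end

lemma dense_spectral_identity: "dense_spectral (\<lambda>b :: 'b::complex_unital_banach_algebra. b)"
  by unfold_locales
    (auto simp: unital_algebra_morphism_def dense_morphism_def spectral_morphism_def)

context dense_spectral
begin

text \<open>Approximate $b$ by images of tuples over the domain. The approximants are unimodular, and by the
openness of orbits within the target, \<open>eventually_in_GL0_orbit\<close> for the identity morphism, they
lie in the orbit of $b$.\<close>

lemma GL0_orbit_meets_image:
  assumes b: "b \<in> Lg m"
  shows "\<exists>a\<in>Lg m. \<exists>u\<in>GL0 m. matrix_act m u b = (\<lambda>i. \<phi> (a i))"
proof -
  define x where "x = (\<lambda>n i. approx (b i) n)"
  have b_tuple: "b \<in> tuples m"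
    using b by (simp add: Lg_iff)
  have lim: "(\<lambda>n. \<phi> (x n i)) \<longlonglongrightarrow> b i" for i
    unfolding x_def by (rule approx_lim)
  have x: "x n \<in> tuples m" for n
    unfolding x_def by (rule approx_tuples[OF b_tuple])
  have "\<forall>\<^sub>F n in sequentially. x n \<in> Lg m"
    by (rule eventually_Lg[OF b _ lim]) (simp add: x)
  moreover have "\<forall>\<^sub>F n in sequentially. \<exists>u\<in>GL0 m. matrix_act m u b = (\<lambda>i. \<phi> (x n i))"
    by (rule dense_spectral.eventually_in_GL0_orbit[OF dense_spectral_identity b])
      (use x in \<open>simp_all add: tuples_def map_zero lim\<close>)
  ultimately have "\<forall>\<^sub>F n in sequentially. x n \<in> Lg m \<and> (\<exists>u\<in>GL0 m. matrix_act m u b = (\<lambda>i. \<phi> (x n i)))"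
    by (rule eventually_conj)
  from eventually_happens'[OF sequentially_bot this] show ?thesis
    by blast
qed

text \<open>From the domain to the target, every orbit meets the image, and the image of a transforming matrix
acts on the images of the tuples. Conversely, if $g$ sends the image of $a$ to the image of $a'$,
then approximants $h$ of $g$ send $a$ to tuples whose images are close to that of $a'$, and these
lie in the orbit of $a'$.\<close>

lemma acts_transitively_on_Lg_iff:
  assumes A: "group_between_GL0_and_GL m A" and B: "group_between_GL0_and_GL m B"
    and map: "\<And>M. M \<in> A \<Longrightarrow> (\<lambda>i j. \<phi> (M i j)) \<in> B"
    and lift: "\<And>g. g \<in> B \<Longrightarrow> \<forall>\<^sub>F n in sequentially. (\<lambda>i j. approx (g i j) n) \<in> A"
  shows "acts_transitively_on_Lg m A \<longleftrightarrow> acts_transitively_on_Lg m B"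
proof
  assume trans: "acts_transitively_on_Lg m A"
  show "acts_transitively_on_Lg m B"
    unfolding acts_transitively_on_Lg_def
  proof (intro ballI)
    fix b b' :: "nat \<Rightarrow> 'b" assume b: "b \<in> Lg m" "b' \<in> Lg m"
    obtain a u where a: "a \<in> Lg m" "u \<in> GL0 m" "matrix_act m u b = (\<lambda>i. \<phi> (a i))"
      using GL0_orbit_meets_image[OF b(1)] by blast
    obtain a' u' where a': "a' \<in> Lg m" "u' \<in> GL0 m" "matrix_act m u' b' = (\<lambda>i. \<phi> (a' i))"
      using GL0_orbit_meets_image[OF b(2)] by blast
    obtain h where h: "h \<in> A" "matrix_act m h a = a'"
      using trans a(1) a'(1) unfolding acts_transitively_on_Lg_def by blast
    have "matrix_act m (\<lambda>i j. \<phi> (h i j)) (\<lambda>i. \<phi> (a i)) = (\<lambda>i. \<phi> (a' i))"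
      unfolding h(2)[symmetric] by (simp add: map_matrix_act)
    then have "matrix_act m u' b' = matrix_act m (matrix_times m (\<lambda>i j. \<phi> (h i j)) u) b"
      by (simp add: matrix_act_times a(3) a'(3))
    moreover have "u \<in> B" "u' \<in> B" "matrix_times m (\<lambda>i j. \<phi> (h i j)) u \<in> B"
      using B a(2) a'(2) map[OF h(1)] unfolding group_between_GL0_and_GL_def by blast+
    moreover have "b' \<in> tuples m"
      using b(2) by (simp add: Lg_iff)
    ultimately show "\<exists>g\<in>B. matrix_act m g b = b'"
      by (intro same_orbit_through_common_point[OF B])
  qed
next
  assume trans: "acts_transitively_on_Lg m B"
  show "acts_transitively_on_Lg m A"
    unfolding acts_transitively_on_Lg_def
  proof (intro ballI)
    fix a a' :: "nat \<Rightarrow> 'a" assume a: "a \<in> Lg m" "a' \<in> Lg m"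
    obtain g where g: "g \<in> B" "matrix_act m g (\<lambda>i. \<phi> (a i)) = (\<lambda>i. \<phi> (a' i))"
      using trans map_Lg[OF a(1)] map_Lg[OF a(2)] unfolding acts_transitively_on_Lg_def by blast
    define h where "h = (\<lambda>n i j. approx (g i j) n)"
    have h: "\<forall>\<^sub>F n in sequentially. h n \<in> A"
      unfolding h_def by (rule lift[OF g(1)])
    then have "\<forall>\<^sub>F n in sequentially. matrix_act m (h n) a \<in> tuples m"
    proof eventually_elim
      case (elim n)
      then show ?case
        using A GL_matrices unfolding group_between_GL0_and_GL_def by (intro matrix_act_tuples) blast
    qed
    moreover have "(\<lambda>n. \<phi> (matrix_act m (h n) a i)) \<longlonglongrightarrow> \<phi> (a' i)" for i
    proof -
      have "(\<lambda>n. \<Sum>j<m. \<phi> (h n i j) * \<phi> (a j)) \<longlonglongrightarrow> (\<Sum>j<m. g i j * \<phi> (a j))"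
        unfolding h_def by (intro tendsto_sum tendsto_mult tendsto_const approx_lim)
      moreover have "(\<Sum>j<m. g i j * \<phi> (a j)) = \<phi> (a' i)"
        using fun_cong[OF g(2), of i] by (simp add: matrix_act_def)
      ultimately show ?thesis
        by (simp add: matrix_act_def map_sum map_mult)
    qed
    ultimately have "\<forall>\<^sub>F n in sequentially. \<exists>u\<in>GL0 m. matrix_act m u a' = matrix_act m (h n) a"
      by (rule eventually_in_GL0_orbit[OF a(2)])
    then have "\<forall>\<^sub>F n in sequentially. h n \<in> A \<and> (\<exists>u\<in>GL0 m. matrix_act m u a' = matrix_act m (h n) a)"
      by (rule eventually_conj[OF h])
    from eventually_happens'[OF sequentially_bot this]
    obtain n u where "h n \<in> A" "u \<in> GL0 m" "matrix_act m u a' = matrix_act m (h n) a"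
      by blast
    moreover from this have "u \<in> A"
      using A unfolding group_between_GL0_and_GL_def by blast
    moreover have "a' \<in> tuples m"
      using a(2) by (simp add: Lg_iff)
    ultimately show "\<exists>g\<in>A. matrix_act m g a = a'"
      by (intro same_orbit_through_common_point[OF A])
  qed
qed

end

theorem theorem10p3:
  fixes \<phi> :: "'a::complex_unital_banach_algebra \<Rightarrow> 'b::complex_unital_banach_algebra"
  assumes "unital_algebra_morphism \<phi>"
    and "continuous_on UNIV \<phi>"
    and "dense_morphism \<phi>"
    and "spectral_morphism \<phi>"
  shows "csr TYPE('a) = csr TYPE('b) \<and> gsr TYPE('a) = gsr TYPE('b)"
proof -
  interpret dense_spectral \<phi>
    by (rule dense_spectral.intro[OF assms])
  have "(\<lambda>m. acts_transitively_on_Lg m (GL0 m :: (nat \<Rightarrow> nat \<Rightarrow> 'a) set)) =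
      (\<lambda>m. acts_transitively_on_Lg m (GL0 m :: (nat \<Rightarrow> nat \<Rightarrow> 'b) set))"
    using acts_transitively_on_Lg_iff[OF group_between_GL0_and_GL_GL0 group_between_GL0_and_GL_GL0]
      map_GL0 eventually_GL0_approx by (intro ext) blast
  moreover have "(\<lambda>m. acts_transitively_on_Lg m (GL m :: (nat \<Rightarrow> nat \<Rightarrow> 'a) set)) =
      (\<lambda>m. acts_transitively_on_Lg m (GL m :: (nat \<Rightarrow> nat \<Rightarrow> 'b) set))"
    using acts_transitively_on_Lg_iff[OF group_between_GL0_and_GL_GL group_between_GL0_and_GL_GL]
      map_GL eventually_GL_approx by (intro ext) blast
  ultimately show ?thesis
    unfolding csr_def gsr_def by (intro conjI arg_cong[where f = least_rank])
qed

end
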